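(* Let $G$ be a finite abstract simplicial complex, let $m\ge1$ and $k\ge1$ be integers, let $R$ be an additively written abelian group (for instance the additive group of a ring), and let $h_m:G^m\to R$ be an arbitrary function. For $A\subseteq G$ define $$ w_m(A)=\sum_{X\in A^m,\ \bigcap X\in A} h_m(X), $$ and for $X=(x_1,\dots,x_k)\in G^k$ define $g_m(X)=w(X)\,w_m(U(X))$, where $w(X)=\prod_{j=1}^k(-1)^{\dim(x_j)}\in\{1,-1\}$ and $U(X)=\bigcap_{j=1}^kU(x_j)$. Then $$ w_m(G)=\sum_{X\in G^m,\ \bigcap X\neq\emptyset} h_m(X)=\sum_{X\in G^k} g_m(X). $$
   Context: A finite abstract simplicial complex $G$ is a finite set of non-empty finite sets, closed under taking non-empty subsets. For $x\in G$, $\dim(x)=|x|-1$. The star of $x\in G$ is $U(x)=\{y\in G : x\subseteq y\}$. For a tuple $X=(x_1,\dots,x_m)$, $\bigcap X$ denotes $\bigcap_{j=1}^m x_j$. Multiplication of an element $r\in R$ by $1$ or $-1$ means $r$ or its additive inverse $-r$. No symmetry of $h_m$ is assumed. *)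

theory Defs
  imports Main
begin

definition simplicial_complex :: "'a set set \<Rightarrow> bool" where
  "simplicial_complex G \<longleftrightarrow>
     finite G \<and>
     (\<forall>x\<in>G. finite x \<and> x \<noteq> {}) \<and>
     (\<forall>x\<in>G. \<forall>y. y \<noteq> {} \<and> y \<subseteq> x \<longrightarrow> y \<in> G)"

text \<open>The truncated subtraction is harmless: simplices are finite and non-empty.\<close>

definition dim :: "'a set \<Rightarrow> nat" where
  "dim x = card x - 1"

definition star :: "'a set set \<Rightarrow> 'a set \<Rightarrow> 'a set set" where
  "star G x = {y \<in> G. x \<subseteq> y}"

text \<open>The Cartesian power \<open>A\<^sup>m\<close>; an \<open>m\<close>-tuple is a list of length \<open>m\<close>.\<close>

definition tuples :: "nat \<Rightarrow> 'b set \<Rightarrow> 'b list set" where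
  "tuples m A = {X. length X = m \<and> set X \<subseteq> A}"

definition tuple_Inter :: "'a set list \<Rightarrow> 'a set" where
  "tuple_Inter X = (\<Inter>x\<in>set X. x)"

definition tuple_star :: "'a set set \<Rightarrow> 'a set list \<Rightarrow> 'a set set" where
  "tuple_star G X = (\<Inter>x\<in>set X. star G x)"

definition tuple_sign :: "'a set list \<Rightarrow> int" where
  "tuple_sign X = (\<Prod>x\<leftarrow>X. (- 1) ^ dim x)"

text \<open>Multiplication of a group element by a sign; only used for \<open>s = 1\<close> and \<open>s = - 1\<close>.\<close>

definition sign_mult :: "int \<Rightarrow> 'r::ab_group_add \<Rightarrow> 'r" where
  "sign_mult s r = (if s = 1 then r else - r)"

definition w_energy :: "nat \<Rightarrow> ('a set list \<Rightarrow> 'r::ab_group_add) \<Rightarrow> 'a set set \<Rightarrow> 'r" where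
  "w_energy m h A = (\<Sum>X | X \<in> tuples m A \<and> tuple_Inter X \<in> A. h X)"

definition g_energy ::
  "'a set set \<Rightarrow> nat \<Rightarrow> ('a set list \<Rightarrow> 'r::ab_group_add) \<Rightarrow> 'a set list \<Rightarrow> 'r" where
  "g_energy G m h X = sign_mult (tuple_sign X) (w_energy m h (tuple_star G X))"

end

theory Submission
  imports Defs
begin

text \<open>Exchange the two summations: a tuple \<open>Y\<close> with intersection \<open>I\<close> is counted once, with sign, for
  every \<open>k\<close>-tuple of non-empty subsets of \<open>I\<close>. The signs of these \<open>k\<close>-tuples add up to the
  \<open>k\<close>-th power of the Euler characteristic of a full simplex, which is 1.
  Since the values lie in an abelian group without multiplication, the power
  is computed by induction on \<open>k\<close>, peeling off one entry of the tuple at a time.\<close>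

lemma sign_mult_1 [simp]: "sign_mult 1 r = r"
  by (simp add: sign_mult_def)

text \<open>Both factors must be signs: \<open>sign_mult\<close> negates for every integer other
  than 1.\<close>

lemma sign_mult_mult:
  assumes "s \<in> {1, -1}" "t \<in> {1, -1}"
  shows "sign_mult (s * t) r = sign_mult s (sign_mult t r)"
  using assms by (auto simp: sign_mult_def)

lemma sign_mult_sum: "sign_mult s (\<Sum>a\<in>A. f a) = (\<Sum>a\<in>A. sign_mult s (f a))"
  by (simp add: sign_mult_def sum_negf)

lemma minus_one_power_sign: "(-1 :: int) ^ n \<in> {1, -1}"
  by (cases "even n") auto

lemma tuple_sign_sign: "tuple_sign X \<in> {1, -1}"
proof (induction X)
  case (Cons x X)
  then show ?case
    using minus_one_power_sign[of "dim x"] by (auto simp: tuple_sign_def)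
qed (simp add: tuple_sign_def)

lemma sign_mult_dim_insert:
  assumes "finite x" "x \<noteq> {}" "v \<notin> x"
  shows "sign_mult ((-1) ^ dim (insert v x)) r = - sign_mult ((-1) ^ dim x) r"
proof -
  have "dim (insert v x) = Suc (dim x)"
    using assms by (simp add: dim_def card_gt_0_iff)
  then show ?thesis
    using minus_one_power_sign[of "dim x"] by (auto simp: sign_mult_def)
qed

text \<open>Toggling a fixed vertex \<open>v\<close> pairs off all faces except \<open>{v}\<close>.\<close>

lemma sum_sign_mult_faces:
  assumes "finite I" "I \<noteq> {}"
  shows "(\<Sum>x\<in>Pow I - {{}}. sign_mult ((-1) ^ dim x) r) = r"
proof -
  let ?f = "\<lambda>x. sign_mult ((-1) ^ dim x) r"
  obtain v where v: "v \<in> I"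
    using assms by blast
  \<comment> \<open>\<open>B\<close> collects the non-empty faces avoiding \<open>v\<close>;
    \<open>insert v\<close> maps it injectively onto the faces that contain \<open>v\<close> and at
    least one other vertex.\<close>
  define B where "B = Pow (I - {v}) - {{}}"
  have fin: "finite B"
    using assms by (simp add: B_def)
  have "Pow I - {{}} = insert {v} (B \<union> insert v ` B)"
  proof (intro equalityI subsetI)
    fix x assume x: "x \<in> Pow I - {{}}"
    show "x \<in> insert {v} (B \<union> insert v ` B)"
    proof (cases "v \<in> x \<and> x \<noteq> {v}")
      case True
      then have "x = insert v (x - {v})" "x - {v} \<in> B"
        using x by (auto simp: B_def)
      then show ?thesis by blast
    next
      case False
      then show ?thesis using x by (auto simp: B_def)
    qed
  qed (use v in \<open>auto simp: B_def\<close>)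
  moreover have "{v} \<notin> B \<union> insert v ` B" "B \<inter> insert v ` B = {}"
    by (auto simp: B_def)
  moreover have "sum ?f (insert v ` B) = (\<Sum>x\<in>B. ?f (insert v x))"
    by (rule sum.reindex_cong[where l = "insert v"])
      (auto simp: B_def inj_on_def insert_ident subset_Diff_insert)
  moreover have "\<dots> = (\<Sum>x\<in>B. - ?f x)"
  proof (intro sum.cong refl sign_mult_dim_insert)
    fix x assume "x \<in> B"
    then show "finite x" "x \<noteq> {}" "v \<notin> x"
      using assms finite_subset by (auto simp: B_def)
  qed
  \<comment> \<open>The sums over \<open>B\<close> and over its image cancel. The vertex
    \<open>{v}\<close> remains; its dimension is 0, so it contributes \<open>r\<close>.\<close>
  ultimately show ?thesis
    using fin by (simp add: sum.union_disjoint sum_negf dim_def)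
qed

lemma finite_tuples: "finite A \<Longrightarrow> finite (tuples m A)"
  unfolding tuples_def using finite_lists_length_eq[of A m] by (simp add: conj_commute)

lemma tuples_0: "tuples 0 A = {[]}"
  by (auto simp: tuples_def)

lemma tuples_Suc: "tuples (Suc k) A = (\<lambda>(x, X). x # X) ` (A \<times> tuples k A)"
  by (auto simp: tuples_def length_Suc_conv image_iff)

lemma sum_tuples_Suc:
  "(\<Sum>X\<in>tuples (Suc k) A. f X) = (\<Sum>x\<in>A. \<Sum>X\<in>tuples k A. f (x # X))"
proof -
  have "inj_on (\<lambda>(x, X). x # X) (A \<times> tuples k A)"
    by (auto simp: inj_on_def)
  then show ?thesis
    by (simp add: tuples_Suc sum.reindex sum.cartesian_product case_prod_unfold)
qed

lemma sum_sign_mult_tuples: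
  assumes "finite I" "I \<noteq> {}"
  shows "(\<Sum>X\<in>tuples k (Pow I - {{}}). sign_mult (tuple_sign X) r) = r"
proof (induction k)
  case 0
  show ?case by (simp add: tuples_0 tuple_sign_def)
next
  case (Suc k)
  have "sign_mult (tuple_sign (x # X)) r
      = sign_mult ((-1) ^ dim x) (sign_mult (tuple_sign X) r)" for x and X :: "'a set list"
    using sign_mult_mult[OF minus_one_power_sign tuple_sign_sign]
    by (simp add: tuple_sign_def)
  \<comment> \<open>For a fixed first entry, additivity of \<open>sign_mult\<close> pulls its sign
    out of the inner sum, which is \<open>r\<close> by the induction hypothesis.\<close>
  then have "(\<Sum>X\<in>tuples (Suc k) (Pow I - {{}}). sign_mult (tuple_sign X) r)
      = (\<Sum>x\<in>Pow I - {{}}. sign_mult ((-1) ^ dim x) r)"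
    by (simp add: sum_tuples_Suc Suc.IH flip: sign_mult_sum)
  then show ?case
    using sum_sign_mult_faces[OF assms] by simp
qed

text \<open>As \<open>m \<ge> 1\<close>, the intersection lies inside some entry, a simplex of
  \<open>G\<close>, so closure under non-empty subsets applies.\<close>

lemma tuple_Inter_in_complex_iff:
  assumes "simplicial_complex G" "m \<ge> 1" "Y \<in> tuples m G"
  shows "tuple_Inter Y \<in> G \<longleftrightarrow> tuple_Inter Y \<noteq> {}"
proof -
  obtain y where y: "y \<in> set Y" "y \<in> G"
    using assms(2,3) by (cases Y) (auto simp: tuples_def)
  then have "tuple_Inter Y \<subseteq> y"
    by (auto simp: tuple_Inter_def)
  with y show ?thesis
    using assms(1) unfolding simplicial_complex_def by blast
qed

text \<open>With \<open>k \<ge> 1\<close> the intersection of stars runs over a non-empty family and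
  so stays inside \<open>G\<close>; over the empty family it would be the whole type.\<close>

lemma in_tuple_star_iff:
  assumes "X \<in> tuples k G" "k \<ge> 1"
  shows "y \<in> tuple_star G X \<longleftrightarrow> y \<in> G \<and> (\<forall>x\<in>set X. x \<subseteq> y)"
  using assms by (cases X) (auto simp: tuples_def tuple_star_def star_def)

text \<open>A simplex lies in all entries of \<open>Y\<close> exactly when it lies in their
  intersection. This gives the relation between \<open>X\<close> and \<open>Y\<close> a form in
  which the sums can be exchanged.\<close>

lemma tuples_tuple_star_iff:
  assumes "X \<in> tuples k G" "k \<ge> 1"
  shows "Y \<in> tuples m (tuple_star G X) \<and> tuple_Inter Y \<in> tuple_star G X \<longleftrightarrow>
    Y \<in> tuples m G \<and> tuple_Inter Y \<in> G \<and> (\<forall>x\<in>set X. x \<subseteq> tuple_Inter Y)"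
proof -
  have "set Y \<subseteq> tuple_star G X \<longleftrightarrow> set Y \<subseteq> G \<and> (\<forall>x\<in>set X. x \<subseteq> tuple_Inter Y)"
    unfolding subset_iff[of "set Y"] in_tuple_star_iff[OF assms] tuple_Inter_def by blast
  then show ?thesis
    unfolding tuples_def mem_Collect_eq in_tuple_star_iff[OF assms] by blast
qed

text \<open>By closure of \<open>G\<close>, the simplices of \<open>G\<close> inside
  \<open>I\<close> are all the non-empty subsets of \<open>I\<close>.\<close>

lemma tuples_faces:
  assumes "simplicial_complex G" "I \<in> G"
  shows "{X \<in> tuples k G. \<forall>x\<in>set X. x \<subseteq> I} = tuples k (Pow I - {{}})"
proof -
  have "x \<in> G \<and> x \<subseteq> I \<longleftrightarrow> x \<in> Pow I - {{}}" for x
    using assms unfolding simplicial_complex_def by blast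
  then have "set X \<subseteq> G \<and> (\<forall>x\<in>set X. x \<subseteq> I) \<longleftrightarrow> set X \<subseteq> Pow I - {{}}" for X
    by (meson subset_iff)
  then show ?thesis
    unfolding tuples_def by simp
qed

lemma sum_g_energy:
  fixes h :: "'a set list \<Rightarrow> 'r::ab_group_add"
  assumes G: "simplicial_complex G" and k: "k \<ge> 1"
  shows "(\<Sum>X\<in>tuples k G. g_energy G m h X) = w_energy m h G"
proof -
  define T where "T = {Y. Y \<in> tuples m G \<and> tuple_Inter Y \<in> G}"
  have finG: "finite G"
    using G by (simp add: simplicial_complex_def)
  have finT: "finite T"
    using finite_tuples[OF finG, of m] by (simp add: T_def)
  have "(\<Sum>X\<in>tuples k G. g_energy G m h X)
      = (\<Sum>X\<in>tuples k G. \<Sum>Y | Y \<in> T \<and> (\<forall>x\<in>set X. x \<subseteq> tuple_Inter Y).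
          sign_mult (tuple_sign X) (h Y))"
    using tuples_tuple_star_iff[OF _ k, of _ G _ m]
    by (intro sum.cong refl) (simp add: g_energy_def w_energy_def sign_mult_sum T_def conj_assoc)
  also have "\<dots> = (\<Sum>Y\<in>T. \<Sum>X | X \<in> tuples k G \<and> (\<forall>x\<in>set X. x \<subseteq> tuple_Inter Y).
          sign_mult (tuple_sign X) (h Y))"
    \<comment> \<open>Both index sets are finite, and the inner range is cut out by one relation
      between \<open>X\<close> and \<open>Y\<close>.\<close>
    by (rule sum.swap_restrict[OF finite_tuples[OF finG] finT])
  also have "\<dots> = (\<Sum>Y\<in>T. h Y)"
  proof (rule sum.cong[OF refl])
    fix Y assume "Y \<in> T"
    then have I: "tuple_Inter Y \<in> G"
      by (simp add: T_def)
    then have "finite (tuple_Inter Y)" "tuple_Inter Y \<noteq> {}"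
      using G by (auto simp: simplicial_complex_def)
    then show "(\<Sum>X | X \<in> tuples k G \<and> (\<forall>x\<in>set X. x \<subseteq> tuple_Inter Y).
        sign_mult (tuple_sign X) (h Y)) = h Y"
      by (simp add: tuples_faces[OF G I] sum_sign_mult_tuples)
  qed
  finally show ?thesis
    by (simp add: w_energy_def T_def)
qed

theorem mainTheorem2:
  fixes G :: "'a set set" and m k :: nat and h :: "'a set list \<Rightarrow> 'r::ab_group_add"
  assumes "simplicial_complex G" and "m \<ge> 1" and "k \<ge> 1"
  shows "w_energy m h G = (\<Sum>X | X \<in> tuples m G \<and> tuple_Inter X \<noteq> {}. h X)
       \<and> (\<Sum>X | X \<in> tuples m G \<and> tuple_Inter X \<noteq> {}. h X) = (\<Sum>X\<in>tuples k G. g_energy G m h X)"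
proof -
  have "w_energy m h G = (\<Sum>X | X \<in> tuples m G \<and> tuple_Inter X \<noteq> {}. h X)"
    unfolding w_energy_def
    using tuple_Inter_in_complex_iff[OF assms(1,2)] by (intro sum.cong) auto
  then show ?thesis
    using sum_g_energy[OF assms(1,3)] by metis
qed

end
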